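(* Let $G$ be any group, $p$ a prime, and $\Omega$ a connected component of $\Gamma_p(G)$. Then there exists $C > 0$ such that any two vertices in $\Omega$ are connected by a path of length less than $C$; that is, the diameter of $\Omega$ is finite. Moreover, if any vertex of $\Omega$ is a normal subgroup of $G$, then the diameter of $\Omega$ is bounded above by $3$.
   Context: For a group $G$ and a prime $p$, the $p$-local commensurability graph $\Gamma_p(G)$ is the simple graph whose vertices are the finite-index subgroups of $G$, where two distinct vertices $A, B \leq G$ are adjacent if and only if $[A : A\cap B][B : A\cap B]$ is a power of $p$. The length of a path is its number of edges; the diameter of a component is the supremum of the distances between its vertices in the path metric. *)

theory Defs
  imports
    "HOL-Algebra.Coset"
    "HOL-Computational_Algebra.Primes"
    "Graph_Theory.Graph_Theory"
begin

text \<open>The index \<open>[A : B]\<close> inside an ambient group. By the convention for \<^const>\<open>card\<close>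
  it is \<open>0\<close> when infinite, so finiteness of an index has to be stated separately.\<close>

definition subgroup_index :: "('a, 'b) monoid_scheme \<Rightarrow> 'a set \<Rightarrow> 'a set \<Rightarrow> nat" where
  "subgroup_index G A B = card (rcosets\<^bsub>G\<lparr>carrier := A\<rparr>\<^esub> B)"

definition finite_index_subgroups :: "('a, 'b) monoid_scheme \<Rightarrow> 'a set set" where
  "finite_index_subgroups G = {H. subgroup H G \<and> finite (rcosets\<^bsub>G\<^esub> H)}"

text \<open>An undirected edge \<open>{A, B}\<close> is represented by the two arcs \<open>(A, B)\<close> and \<open>(B, A)\<close>.
  The indices below are finite because \<open>A \<inter> B\<close> has finite index in \<open>G\<close>.\<close>

definition local_commensurability_graph ::
    "('a, 'b) monoid_scheme \<Rightarrow> nat \<Rightarrow> 'a set pair_pre_digraph" where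
  "local_commensurability_graph G p =
    \<lparr> pverts = finite_index_subgroups G,
      parcs = {(A, B). A \<in> finite_index_subgroups G \<and> B \<in> finite_index_subgroups G \<and> A \<noteq> B \<and>
        (\<exists>k. subgroup_index G A (A \<inter> B) * subgroup_index G B (A \<inter> B) = p ^ k)} \<rparr>"

lemma pair_bidirected_digraph_local_commensurability_graph:
  "pair_bidirected_digraph (local_commensurability_graph G p)"
  by unfold_locales
    (auto simp: local_commensurability_graph_def symmetric_def Int_commute mult.commute
      intro!: symI)

text \<open>In a symmetric digraph this is the usual notion: a maximal connected subgraph.\<close>

definition (in pre_digraph) connected_component :: "('a, 'b) pre_digraph \<Rightarrow> bool" where
  "connected_component H \<longleftrightarrow> max_subgraph Digraph_Component.connected H"

text \<open>With unit weights, \<open>\<mu>\<close> is the infimum of the numbers of arcs of the walks from \<open>u\<close> to \<open>v\<close>,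
  i.e. the path metric (\<open>\<infinity>\<close> if there is no walk).\<close>

definition (in wf_digraph) diameter :: ereal where
  "diameter = (SUP u\<in>verts G. SUP v\<in>verts G. \<mu> (\<lambda>_. 1) u v)"

end

theory Submission
  imports Defs "HOL-Algebra.SndIsomorphismGrp"
begin

text \<open>Two subgroups \<open>B\<close> and \<open>B'\<close> of finite index are equal or adjacent exactly if \<open>B \<inter> B'\<close> has
  \<open>p\<close>-power index in both. The proof compares a vertex \<open>B\<close> with \<open>NB\<close> for a suitable normal subgroup \<open>N\<close>. If \<open>C \<subseteq> B\<close>, then
  \<open>[NB : NC]\<close> divides \<open>[B : C]\<close>; so multiplication by \<open>N\<close> preserves \<open>p\<close>-power indices. It follows
  (\<open>power_index_normal_mult_step\<close>) that if \<open>B\<close> has \<open>p\<close>-power index in \<open>NB\<close>, then so does every neighbour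
  \<open>B'\<close> of \<open>B\<close> in \<open>NB'\<close>.

  For the first claim, let \<open>K\<close> be the normal core of some vertex \<open>A\<close> of the component. Since \<open>KA = A\<close>, following
  walks from \<open>A\<close> shows that every vertex \<open>B\<close> has \<open>p\<close>-power index in \<open>KB\<close>. Thus \<open>B\<close> is adjacent
  or equal to \<open>KB\<close>, which contains \<open>K\<close>. As \<open>K\<close> has finite index, it has finitely many overgroups, and those in
  the component form a finite dominating set. The walks among them have bounded length, and two more arcs
  join arbitrary vertices.

  For the second claim, let \<open>N\<close> be a normal vertex. Then not only \<open>B\<close> but, by the same propagation along
  walks, also \<open>N\<close> has \<open>p\<close>-power index in \<open>NB\<close>. The product formula turns this into adjacency
  of \<open>B\<close> and \<open>N\<close>, so any two vertices are joined through \<open>N\<close> by a walk of length at most \<open>2\<close>.\<close>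

section \<open>Indices of products of subgroups\<close>

context group begin

lemma rcosets_restrict: "rcosets\<^bsub>G\<lparr>carrier := A\<rparr>\<^esub> B = (\<lambda>a. B #> a) ` A"
  by (auto simp: RCOSETS_def)

text \<open>With a representative \<open>r D\<close> chosen in each coset \<open>D\<close> of \<open>B\<close> in \<open>A\<close>, every coset of \<open>C\<close> in \<open>A\<close>
  is \<open>E #> r D\<close> for exactly one \<open>D\<close> and one coset \<open>E\<close> of \<open>C\<close> in \<open>B\<close>. If an index is
  infinite, the equation reads \<open>0 = 0\<close>, since a product of nonempty sets is infinite once a factor is.\<close>

lemma subgroup_index_mult:
  assumes A: "subgroup A G" and B: "subgroup B G" and C: "subgroup C G"
    and "C \<subseteq> B" "B \<subseteq> A"
  shows "subgroup_index G A C = subgroup_index G A B * subgroup_index G B C"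
proof -
  let ?AB = "(\<lambda>a. B #> a) ` A" and ?BC = "(\<lambda>b. C #> b) ` B" and ?AC = "(\<lambda>a. C #> a) ` A"
  have sub: "A \<subseteq> carrier G" "B \<subseteq> carrier G" "C \<subseteq> carrier G"
    using A B C subgroup.subset by auto
  define r where "r D = (SOME a. a \<in> A \<and> D = B #> a)" for D
  have r: "r D \<in> A \<and> D = B #> r D" if "D \<in> ?AB" for D
    unfolding r_def by (rule someI_ex) (use that in blast)
  have sub_coset: "E #> r D \<subseteq> D" if D: "D \<in> ?AB" and E: "E \<in> ?BC" for D E
  proof -
    obtain b where b: "b \<in> B" "E = C #> b" using E by blast
    have "E \<subseteq> B"
      using b \<open>C \<subseteq> B\<close> B by (auto simp: r_coset_def subgroup.m_closed)
    then show ?thesis using r[OF D] unfolding r_coset_def by blast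
  qed
  have "bij_betw (\<lambda>(D, E). E #> r D) (?AB \<times> ?BC) ?AC"
  proof (intro bij_betw_imageI inj_onI)
    fix x y assume x: "x \<in> ?AB \<times> ?BC" and y: "y \<in> ?AB \<times> ?BC"
      and eq: "(\<lambda>(D, E). E #> r D) x = (\<lambda>(D, E). E #> r D) y"
    obtain D E D' E' where xy: "x = (D, E)" "y = (D', E')" by fastforce
    have D: "D \<in> ?AB" "D' \<in> ?AB" and E: "E \<in> ?BC" "E' \<in> ?BC" using x y xy by auto
    have eq': "E #> r D = E' #> r D'" using eq xy by simp
    have rc: "r D \<in> carrier G" using r[OF D(1)] sub by auto
    obtain b where b: "b \<in> B" "E = C #> b" using E by blast
    have "b \<in> E" using b C sub rcos_self by auto
    then have "b \<otimes> r D \<in> E #> r D" unfolding r_coset_def by blast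
    then have "b \<otimes> r D \<in> D" "b \<otimes> r D \<in> D'"
      using sub_coset[OF D(1) E(1)] sub_coset[OF D(2) E(2)] eq' by auto
    moreover have "D \<in> rcosets B" "D' \<in> rcosets B"
      using D sub by (auto simp: RCOSETS_def)
    ultimately have DD: "D = D'"
      using rcos_disjoint[OF B] by (auto simp: pairwise_def disjnt_def)
    have "E \<subseteq> carrier G" "E' \<subseteq> carrier G"
      using E sub by (auto simp: r_coset_def)
    then have "E = E'"
      using eq' rc unfolding DD[symmetric]
      by (metis coset_mult_assoc coset_mult_one inv_closed r_inv)
    then show "x = y" using DD xy by simp
  next
    show "(\<lambda>(D, E). E #> r D) ` (?AB \<times> ?BC) = ?AC"
    proof (intro subset_antisym subsetI)
      fix F assume "F \<in> (\<lambda>(D, E). E #> r D) ` (?AB \<times> ?BC)"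
      then obtain D b where D: "D \<in> ?AB" and b: "b \<in> B" and F: "F = (C #> b) #> r D" by auto
      have "F = C #> (b \<otimes> r D)"
        using F b r[OF D] sub by (simp add: coset_mult_assoc subset_iff)
      moreover have "b \<otimes> r D \<in> A"
        using b r[OF D] \<open>B \<subseteq> A\<close> A by (simp add: subgroup.m_closed subset_iff)
      ultimately show "F \<in> ?AC" by blast
    next
      fix F assume "F \<in> ?AC"
      then obtain a where a: "a \<in> A" and F: "F = C #> a" by blast
      define D where "D = B #> a"
      have D: "D \<in> ?AB" using a D_def by blast
      have rc: "r D \<in> carrier G" "a \<in> carrier G" using r[OF D] a sub by auto
      have "a \<in> B #> r D" using r[OF D] rcos_self[OF rc(2) B] D_def by auto
      then obtain b where b: "b \<in> B" "a = b \<otimes> r D" by (auto simp: r_coset_def)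
      have "F = (C #> b) #> r D"
        using F b rc sub by (simp add: coset_mult_assoc subset_iff)
      then show "F \<in> (\<lambda>(D, E). E #> r D) ` (?AB \<times> ?BC)"
        using D b by auto
    qed
  qed
  then have "card (?AB \<times> ?BC) = card ?AC" by (rule bij_betw_same_card)
  then show ?thesis
    by (simp add: subgroup_index_def rcosets_restrict card_cartesian_product)
qed

text \<open>The product formula \<open>[XH : X] = [H : H \<inter> X]\<close>: every coset of \<open>X\<close> in \<open>XH\<close> has a representative
  in \<open>H\<close>, and intersecting with \<open>H\<close> turns it into a coset of \<open>H \<inter> X\<close>.\<close>

lemma subgroup_index_set_mult:
  assumes X: "subgroup X G" and H: "subgroup H G"
  shows "subgroup_index G (X <#> H) X = subgroup_index G H (H \<inter> X)"
proof -
  have sub: "X \<subseteq> carrier G" "H \<subseteq> carrier G"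
    using X H subgroup.subset by auto
  have absorb: "X #> (x \<otimes> h) = X #> h" if "x \<in> X" "h \<in> H" for x h
    using that sub X by (simp add: coset_mult_assoc[symmetric] coset_join2 subset_iff)
  have "(\<lambda>g. X #> g) ` (X <#> H) = (\<lambda>h. X #> h) ` H"
  proof (intro subset_antisym subsetI)
    fix D assume "D \<in> (\<lambda>g. X #> g) ` (X <#> H)"
    then show "D \<in> (\<lambda>h. X #> h) ` H"
      by (auto simp: set_mult_def absorb)
  next
    fix D assume "D \<in> (\<lambda>h. X #> h) ` H"
    then obtain h where h: "h \<in> H" "D = X #> h" by blast
    have "\<one> \<otimes> h \<in> X <#> H"
      using h X by (auto simp: set_mult_def intro: subgroup.one_closed)
    moreover have "D = X #> (\<one> \<otimes> h)" using absorb[OF subgroup.one_closed[OF X] h(1)] h by simp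
    ultimately show "D \<in> (\<lambda>g. X #> g) ` (X <#> H)" by blast
  qed
  moreover have "(\<lambda>D. D \<inter> H) ` (\<lambda>h. X #> h) ` H = (\<lambda>h. (H \<inter> X) #> h) ` H"
  proof -
    have "(X #> h) \<inter> H = (H \<inter> X) #> h" if h: "h \<in> H" for h
    proof (intro subset_antisym subsetI)
      fix g assume "g \<in> (X #> h) \<inter> H"
      then obtain x where x: "x \<in> X" "g = x \<otimes> h" "g \<in> H" by (auto simp: r_coset_def)
      have "x = g \<otimes> inv h" using x h sub by (simp add: inv_solve_right subset_iff)
      then have "x \<in> H" using x h H by (metis subgroup.m_closed subgroup.m_inv_closed)
      then show "g \<in> (H \<inter> X) #> h" using x by (auto simp: r_coset_def)
    next
      fix g assume "g \<in> (H \<inter> X) #> h"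
      then show "g \<in> (X #> h) \<inter> H" using h H by (auto simp: r_coset_def subgroup.m_closed)
    qed
    then show ?thesis by (auto simp: image_image)
  qed
  moreover have "inj_on (\<lambda>D. D \<inter> H) ((\<lambda>h. X #> h) ` H)"
  proof (intro inj_onI)
    fix D E assume D: "D \<in> (\<lambda>h. X #> h) ` H" and E: "E \<in> (\<lambda>h. X #> h) ` H"
      and eq: "D \<inter> H = E \<inter> H"
    obtain h where h: "h \<in> H" "D = X #> h" using D by blast
    have "h \<in> D \<inter> H" using h sub X rcos_self by auto
    then have "h \<in> D" "h \<in> E" using eq by auto
    moreover have "D \<in> rcosets X" "E \<in> rcosets X" using D E sub by (auto simp: RCOSETS_def)
    ultimately show "D = E"
      using rcos_disjoint[OF X] by (auto simp: pairwise_def disjnt_def)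
  qed
  ultimately show ?thesis
    by (metis card_image rcosets_restrict subgroup_index_def)
qed

lemma set_mult_normal:
  assumes N: "N \<lhd> G" and B: "subgroup B G"
  shows "subgroup (N <#> B) G" "N \<subseteq> N <#> B" "B \<subseteq> N <#> B"
proof -
  interpret second_isomorphism_grp N G B
    using N B by (simp add: second_isomorphism_grp_def second_isomorphism_grp_axioms_def)
  show "subgroup (N <#> B) G" "N \<subseteq> N <#> B" "B \<subseteq> N <#> B"
    by (rule normal_set_mult_subgroup H_contained_in_set_mult S_contained_in_set_mult)+
qed

text \<open>The product formula for \<open>X = NC\<close> and \<open>H = B\<close> gives \<open>[NB : NC] = [B : B \<inter> NC]\<close>, and
  \<open>B \<inter> NC\<close> lies between \<open>C\<close> and \<open>B\<close>.\<close>

lemma subgroup_index_normal_mult_dvd: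
  assumes N: "N \<lhd> G" and B: "subgroup B G" and C: "subgroup C G" and "C \<subseteq> B"
  shows "subgroup_index G (N <#> B) (N <#> C) dvd subgroup_index G B C"
proof -
  have N': "subgroup N G" using N by (rule normal_imp_subgroup)
  have sub: "N \<subseteq> carrier G" "B \<subseteq> carrier G" "C \<subseteq> carrier G"
    using N' B C subgroup.subset by auto
  note NC = set_mult_normal[OF N C]
  have "C <#> B = B"
  proof (intro subset_antisym subsetI)
    fix x assume "x \<in> C <#> B"
    then show "x \<in> B" using \<open>C \<subseteq> B\<close> B by (auto simp: set_mult_def subgroup.m_closed)
  next
    fix x assume x: "x \<in> B"
    then have "\<one> \<otimes> x \<in> C <#> B" using C unfolding set_mult_def by (blast intro: subgroup.one_closed)
    then show "x \<in> C <#> B" using x sub by auto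
  qed
  then have "(N <#> C) <#> B = N <#> B"
    using sub by (simp add: set_mult_assoc)
  then have "subgroup_index G (N <#> B) (N <#> C) = subgroup_index G B (B \<inter> (N <#> C))"
    using subgroup_index_set_mult[OF NC(1) B] by simp
  also have "\<dots> dvd subgroup_index G B C"
  proof -
    have "subgroup (B \<inter> (N <#> C)) G" using B NC(1) by (rule subgroups_Inter_pair)
    then show ?thesis
      using subgroup_index_mult[OF B _ C, of "B \<inter> (N <#> C)"] NC(3) \<open>C \<subseteq> B\<close> by simp
  qed
  finally show ?thesis .
qed

end

section \<open>Subgroups of p-power index\<close>

context group begin

text \<open>As \<open>p ^ k > 0\<close> for a prime \<open>p\<close>, the condition on the cardinality includes that the index is
  finite.\<close>

definition power_index :: "nat \<Rightarrow> 'a set \<Rightarrow> 'a set \<Rightarrow> bool" where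
  "power_index p A B \<longleftrightarrow>
    subgroup A G \<and> subgroup B G \<and> B \<subseteq> A \<and> (\<exists>k. subgroup_index G A B = p ^ k)"

lemma power_index_refl:
  assumes "subgroup A G"
  shows "power_index p A A"
proof -
  have "A #> a = A" if "a \<in> A" for a
    using that assms coset_join2 subgroup.mem_carrier by metis
  then have "(\<lambda>a. A #> a) ` A = {A}"
    using subgroup.one_closed[OF assms] by (auto simp: image_iff)
  then have "subgroup_index G A A = p ^ 0"
    by (simp add: subgroup_index_def rcosets_restrict)
  then show ?thesis using assms by (auto simp: power_index_def simp del: power_0)
qed

lemma power_index_trans:
  assumes "power_index p A B" "power_index p B C"
  shows "power_index p A C"
  using assms subgroup_index_mult[of A B C]
  by (auto simp: power_index_def simp flip: power_add)

lemma power_index_intermediate: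
  assumes "prime p" "power_index p A C" "subgroup B G" "C \<subseteq> B" "B \<subseteq> A"
  shows "power_index p A B" "power_index p B C"
proof -
  obtain k where "subgroup_index G A B * subgroup_index G B C = p ^ k"
    using assms subgroup_index_mult[of A B C] by (auto simp: power_index_def)
  then have "subgroup_index G A B dvd p ^ k" "subgroup_index G B C dvd p ^ k"
    by (metis dvd_triv_left, metis dvd_triv_right)
  then show "power_index p A B" "power_index p B C"
    using assms by (auto simp: power_index_def divides_primepow_nat)
qed

lemma power_index_normal_mult:
  assumes "prime p" "N \<lhd> G" "power_index p B C"
  shows "power_index p (N <#> B) (N <#> C)"
proof -
  have "subgroup B G" "subgroup C G" "C \<subseteq> B" using assms by (auto simp: power_index_def)
  moreover have "N <#> C \<subseteq> N <#> B" using \<open>C \<subseteq> B\<close> by (auto simp: set_mult_def)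
  ultimately show ?thesis
    using assms subgroup_index_normal_mult_dvd[of N B C] set_mult_normal(1)[of N]
    by (auto simp: power_index_def divides_primepow_nat)
qed

text \<open>The condition on the product of the two indices splits, because a product is a power of a prime exactly
  if both factors are.\<close>

lemma local_commensurability_arc_iff:
  assumes "prime p"
  shows "(A, B) \<in> parcs (local_commensurability_graph G p) \<longleftrightarrow>
    A \<in> finite_index_subgroups G \<and> B \<in> finite_index_subgroups G \<and> A \<noteq> B \<and>
    power_index p A (A \<inter> B) \<and> power_index p B (A \<inter> B)"
proof -
  have "(\<exists>k. m * n = p ^ k) \<longleftrightarrow> (\<exists>k. m = p ^ k) \<and> (\<exists>k. n = p ^ k)" for m n
    using assms divides_primepow_nat[of p]
    by (metis dvd_triv_left dvd_triv_right power_add)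
  then show ?thesis
    by (auto simp: local_commensurability_graph_def power_index_def finite_index_subgroups_def
        subgroups_Inter_pair)
qed

text \<open>With \<open>C = B \<inter> B'\<close>, the subgroup \<open>C\<close> has \<open>p\<close>-power index in \<open>NB\<close>, hence in \<open>NC\<close>, which lies between
  \<open>C\<close> and \<open>NB\<close>. Multiplying \<open>C \<subseteq> B'\<close> by \<open>N\<close> shows that \<open>C\<close> also has \<open>p\<close>-power index in \<open>NB'\<close>, and
  \<open>B'\<close> lies between \<open>C\<close> and \<open>NB'\<close>.\<close>

lemma power_index_normal_mult_step:
  assumes p: "prime p" and N: "N \<lhd> G"
    and B: "power_index p B (B \<inter> B')" and B': "power_index p B' (B \<inter> B')"
    and inv: "power_index p (N <#> B) B"
  shows "power_index p (N <#> B') B'"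
proof -
  let ?C = "B \<inter> B'"
  have sub: "subgroup B G" "subgroup B' G" "subgroup ?C G"
    using B B' by (auto simp: power_index_def)
  have "N <#> ?C \<subseteq> N <#> B" by (auto simp: set_mult_def)
  then have "power_index p (N <#> ?C) ?C"
    using power_index_intermediate(2)[OF p power_index_trans[OF inv B]] set_mult_normal[OF N sub(3)]
    by blast
  then have "power_index p (N <#> B') ?C"
    using power_index_trans power_index_normal_mult[OF p N B'] by blast
  then show ?thesis
    using power_index_intermediate(1)[OF p] sub(2) set_mult_normal(3)[OF N sub(2)] by blast
qed

text \<open>The same passage from \<open>NB\<close> through \<open>N(B \<inter> B')\<close> to \<open>NB'\<close>, now above the fixed subgroup \<open>N\<close>.\<close>

lemma power_index_over_normal_step:
  assumes p: "prime p" and N: "N \<lhd> G"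
    and B: "power_index p B (B \<inter> B')" and B': "power_index p B' (B \<inter> B')"
    and inv: "power_index p (N <#> B) N"
  shows "power_index p (N <#> B') N"
proof -
  let ?C = "B \<inter> B'"
  have sub: "subgroup ?C G" using B by (auto simp: power_index_def)
  have "N <#> ?C \<subseteq> N <#> B" by (auto simp: set_mult_def)
  then have "power_index p (N <#> ?C) N"
    using power_index_intermediate(2)[OF p inv] set_mult_normal[OF N sub] by blast
  then show ?thesis
    using power_index_trans power_index_normal_mult[OF p N B'] by blast
qed

text \<open>Both indices are given by the product formula, since \<open>NB = BN\<close>.\<close>

lemma power_index_Int_normal:
  assumes N: "N \<lhd> G" and "power_index p (N <#> B) B" "power_index p (N <#> B) N"
  shows "power_index p B (B \<inter> N)" "power_index p N (B \<inter> N)"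
proof -
  have sub: "subgroup B G" "subgroup N G"
    using assms by (auto simp: power_index_def)
  show "power_index p B (B \<inter> N)"
    using assms subgroup_index_set_mult[OF sub(2,1)] sub subgroups_Inter_pair[OF sub]
    by (auto simp: power_index_def)
  show "power_index p N (B \<inter> N)"
    using assms subgroup_index_set_mult[OF sub] commut_normal[OF sub(1) N] sub
      subgroups_Inter_pair[OF sub]
    by (auto simp: power_index_def Int_commute)
qed

end

section \<open>Subgroups of finite index\<close>

context group begin

lemma finite_index_overgroup:
  assumes B: "B \<in> finite_index_subgroups G" and M: "subgroup M G" and "B \<subseteq> M"
  shows "M \<in> finite_index_subgroups G"
proof -
  have B': "subgroup B G" "finite (rcosets B)"
    using B by (auto simp: finite_index_subgroups_def)
  have sub: "B \<subseteq> carrier G" "M \<subseteq> carrier G" using B' M subgroup.subset by auto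
  have "M <#> B = M"
    using M B'(1) \<open>B \<subseteq> M\<close> set_mult_subgroup_idem subgroup_incl by blast
  then have "M #> a = M <#> (B #> a)" if "a \<in> carrier G" for a
    using that sub by (simp add: setmult_rcos_assoc)
  then have "rcosets M \<subseteq> (\<lambda>D. M <#> D) ` (rcosets B)"
    by (auto simp: RCOSETS_def)
  then have "finite (rcosets M)" using B'(2) finite_surj by blast
  then show ?thesis using M by (simp add: finite_index_subgroups_def)
qed

text \<open>The core is the kernel of the action of the group on the finitely many cosets of \<open>A\<close> by right
  multiplication; its cosets correspond to the permutations that occur.\<close>

lemma finite_index_normal_core:
  assumes A: "A \<in> finite_index_subgroups G"
  obtains K where "K \<lhd> G" "K \<subseteq> A" "finite (rcosets K)"
proof
  let ?K = "{k \<in> carrier G. \<forall>D\<in>rcosets A. D #> k = D}"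
  have A': "subgroup A G" "finite (rcosets A)"
    using A by (auto simp: finite_index_subgroups_def)
  have coset_sub: "D \<subseteq> carrier G" if "D \<in> rcosets A" for D
    using that A' rcosets_part_G by blast
  have act: "D #> g \<in> rcosets A" if "D \<in> rcosets A" "g \<in> carrier G" for D g
    using that A'(1)[THEN subgroup.subset] by (auto simp: RCOSETS_def coset_mult_assoc)
  have inv: "D #> inv k = D" if k: "k \<in> ?K" and D: "D \<in> rcosets A" for D k
  proof -
    have "D #> inv k = (D #> k) #> inv k" using k D by simp
    also have "\<dots> = D" using k coset_sub[OF D] by (simp add: coset_mult_assoc)
    finally show ?thesis .
  qed
  have K: "subgroup ?K G"
  proof (rule subgroupI)
    show "?K \<noteq> {}" using coset_sub by (auto intro!: exI[of _ \<one>])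
    show "inv k \<in> ?K" if "k \<in> ?K" for k using that inv[OF that] by auto
    show "k \<otimes> l \<in> ?K" if "k \<in> ?K" "l \<in> ?K" for k l
      using that coset_sub by (auto simp: coset_mult_assoc[symmetric])
  qed auto
  show "?K \<lhd> G"
    unfolding normal_inv_iff
  proof (intro conjI ballI K)
    fix x k assume x: "x \<in> carrier G" and k: "k \<in> ?K"
    have "D #> (x \<otimes> k \<otimes> inv x) = D" if D: "D \<in> rcosets A" for D
    proof -
      have "D #> (x \<otimes> k \<otimes> inv x) = ((D #> x) #> k) #> inv x"
        using x k coset_sub[OF D] by (simp add: coset_mult_assoc m_assoc)
      also have "\<dots> = (D #> x) #> inv x" using k act[OF D x] by simp
      also have "\<dots> = D" using x coset_sub[OF D] by (simp add: coset_mult_assoc)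
      finally show ?thesis .
    qed
    then show "x \<otimes> k \<otimes> inv x \<in> ?K" using x k by auto
  qed
  show "?K \<subseteq> A"
  proof
    fix k assume k: "k \<in> ?K"
    have "A \<in> rcosets A" using A'(1) is_group by (rule subgroup.subgroup_in_rcosets)
    then show "k \<in> A" using k coset_join1[OF _ _ A'(1)] by simp
  qed
  show "finite (rcosets ?K)"
  proof -
    \<comment> \<open>The permutation of the cosets of \<open>A\<close> determines the coset of the kernel.\<close>
    define perm where "perm g = (\<lambda>D\<in>rcosets A. D #> g)" for g
    have same: "?K #> g = ?K #> h"
      if g: "g \<in> carrier G" and h: "h \<in> carrier G" and eq: "perm g = perm h" for g h
    proof -
      have "D #> (g \<otimes> inv h) = D" if D: "D \<in> rcosets A" for D
      proof -
        have "D #> g = D #> h" using eq D by (metis perm_def restrict_apply')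
        then show ?thesis
          using g h coset_sub[OF D] by (metis coset_mult_inv2)
      qed
      then have "g \<otimes> inv h \<in> ?K" using g h by simp
      then have "?K #> (g \<otimes> inv h) = ?K" using g h by (intro coset_join2[OF _ K]) auto
      then show ?thesis
        by (rule coset_mult_inv1) (use g h in auto)
    qed
    have "perm ` carrier G \<subseteq> (\<Pi>\<^sub>E D\<in>rcosets A. rcosets A)"
      using act by (auto simp: perm_def)
    then have "finite (perm ` carrier G)"
      using A'(2) by (meson finite_PiE finite_subset)
    moreover have "rcosets ?K = (\<lambda>f. ?K #> inv_into (carrier G) perm f) ` perm ` carrier G"
    proof -
      have "?K #> inv_into (carrier G) perm (perm g) = ?K #> g" if "g \<in> carrier G" for g
        using that by (intro same) (auto intro: inv_into_into f_inv_into_f)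
      then show ?thesis by (auto simp: RCOSETS_def image_image)
    qed
    ultimately show ?thesis by simp
  qed
qed

text \<open>A subgroup that contains \<open>K\<close> is a union of cosets of \<open>K\<close>.\<close>

lemma finite_overgroups:
  assumes K: "subgroup K G" and fin: "finite (rcosets K)"
  shows "finite {M. subgroup M G \<and> K \<subseteq> M}"
proof (rule finite_subset)
  have union: "M = \<Union> ((\<lambda>a. K #> a) ` M)" if M: "subgroup M G" "K \<subseteq> M" for M
  proof (intro subset_antisym subsetI)
    fix a assume "a \<in> M"
    then have "a \<in> K #> a" using rcos_self[OF _ K] subgroup.mem_carrier[OF M(1)] by blast
    then show "a \<in> \<Union> ((\<lambda>a. K #> a) ` M)" using \<open>a \<in> M\<close> by blast
  next
    fix a assume "a \<in> \<Union> ((\<lambda>a. K #> a) ` M)"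
    then show "a \<in> M" using M by (auto simp: r_coset_def intro: subgroup.m_closed[OF M(1)])
  qed
  have pow: "(\<lambda>a. K #> a) ` M \<subseteq> rcosets K" if "subgroup M G" for M
    using subgroup.mem_carrier[OF that] by (auto simp: RCOSETS_def)
  show "{M. subgroup M G \<and> K \<subseteq> M} \<subseteq> \<Union> ` Pow (rcosets K)"
  proof (intro subsetI)
    fix M assume "M \<in> {M. subgroup M G \<and> K \<subseteq> M}"
    then show "M \<in> \<Union> ` Pow (rcosets K)"
      using union[of M] pow[of M] by (intro image_eqI[of _ _ "(\<lambda>a. K #> a) ` M"]) auto
  qed
  show "finite (\<Union> ` Pow (rcosets K))" using fin by simp
qed

end

section \<open>Components and distances in symmetric digraphs\<close>

lemma strongly_connected_imp_connected:
  assumes "wf_digraph H" "strongly_connected H"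
  shows "connected H"
  using assms by (auto simp: connected_def strongly_connected_def
      intro: wf_digraph.reachable_mk_symmetricI)

context sym_digraph begin

text \<open>Adding arcs between existing vertices keeps a graph connected, so a maximal connected subgraph has
  all of them.\<close>

lemma connected_component_induced:
  assumes "connected_component H"
  shows "induced_subgraph H G"
proof -
  have "arc_mono (connected :: ('a, 'b) pre_digraph \<Rightarrow> bool)"
    unfolding arc_mono_def
  proof (intro allI impI, elim conjE)
    fix H1 H2 :: "('a, 'b) pre_digraph"
    assume "connected H1" "subgraph H1 H2" "verts H1 = verts H2"
    then show "connected H2"
      using wf_digraph.connected_spanning_imp_connected[of H2 H1]
      by (simp add: spanning_def subgraph_def)
  qed
  then show ?thesis
    using assms induced_subgraphI_arc_mono by (simp add: connected_component_def)
qed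

lemma connected_component_sym_digraph:
  assumes "connected_component H"
  shows "sym_digraph H"
  using connected_component_induced[OF assms] induced_graph_imp_symmetric[OF sym_arcs]
    wf_digraphI_induced by (simp add: sym_digraph_def sym_digraph_axioms_def)

lemma connected_component_strongly_connected:
  assumes "connected_component H"
  shows "strongly_connected H"
proof -
  interpret H: sym_digraph H using assms by (rule connected_component_sym_digraph)
  show ?thesis
    using assms max_subgraph_prop H.symmetric_connected_imp_strongly_connected H.sym_arcs
    by (auto simp: connected_component_def)
qed

text \<open>A component of a symmetric digraph is also a maximal strongly connected subgraph, and the
  latter are closed under reachability in both directions.\<close>

lemma connected_component_closed:
  assumes H: "connected_component H" and e: "e \<in> arcs G" "tail G e \<in> verts H"
  shows "e \<in> arcs H"
proof -
  have ind: "induced_subgraph H G" using H by (rule connected_component_induced)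
  have "max_subgraph strongly_connected H"
  proof (rule max_subgraphI)
    show "strongly_connected H" "subgraph H G"
      using connected_component_strongly_connected[OF H] ind by auto
    fix y assume "H \<noteq> y" "subgraph H y" "subgraph y G"
    moreover from this have "wf_digraph y" by (simp add: subgraph_def)
    ultimately show "\<not> strongly_connected y"
      using H strongly_connected_imp_connected[of y]
      by (auto simp: connected_component_def max_subgraph_def)
  qed
  then have "verts H \<in> sccs_verts" using sccs_altdef2 sccs_verts_conv by blast
  moreover have "tail G e \<rightarrow>\<^sup>* head G e" using e(1) by (intro reachable_adjI) (rule in_arcs_imp_in_arcs_ends)
  moreover from this have "head G e \<rightarrow>\<^sup>* tail G e" by (rule symmetric_reachable[OF sym_arcs])
  ultimately have "head G e \<in> verts H"
    using e(2) unfolding in_sccs_verts_conv_reachable by blast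
  then show ?thesis using ind e by (simp add: induced_subgraph_def)
qed

text \<open>A walk between any two vertices can enter the dominating set \<open>S\<close> with its first step and leave it with its
  last.\<close>

lemma walk_bound_of_dominating_set:
  assumes dom: "\<And>u. u \<in> verts G \<Longrightarrow> \<exists>s\<in>S. u = s \<or> u \<rightarrow> s"
    and S: "\<And>s t. s \<in> S \<Longrightarrow> t \<in> S \<Longrightarrow> \<exists>q. awalk s q t \<and> length q \<le> L"
    and u: "u \<in> verts G" and v: "v \<in> verts G"
  shows "\<exists>q. awalk u q v \<and> length q \<le> L + 2"
proof -
  have step: "\<exists>q. awalk x q y \<and> length q \<le> 1" if xy: "x = y \<or> x \<rightarrow> y" "x \<in> verts G" for x y
  proof (cases "x = y")
    case True
    then show ?thesis using xy by (intro exI[of _ "[]"]) (simp add: awalk_Nil_iff)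
  next
    case False
    then obtain e where "e \<in> arcs G" "tail G e = x" "head G e = y"
      using xy by (auto simp: arcs_ends_conv)
    then show ?thesis using arc_implies_awalk by (intro exI[of _ "[e]"]) auto
  qed
  obtain s t where s: "s \<in> S" "u = s \<or> u \<rightarrow> s" and t: "t \<in> S" "v = t \<or> v \<rightarrow> t"
    using dom u v by meson
  have t': "t = v \<or> t \<rightarrow> v" using t graph_symmetric by blast
  have "t \<in> verts G" using t v by auto
  obtain q1 where 1: "awalk u q1 s" "length q1 \<le> 1" using step[OF s(2) u] by blast
  obtain q2 where 2: "awalk s q2 t" "length q2 \<le> L" using S[OF s(1) t(1)] by blast
  obtain q3 where 3: "awalk t q3 v" "length q3 \<le> 1" using step[OF t' \<open>t \<in> verts G\<close>] by blast
  have "awalk u (q1 @ q2 @ q3) v" using 1 2 3 by (meson awalk_appendI)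
  then show ?thesis using 1 2 3 by (intro exI[of _ "q1 @ q2 @ q3"]) auto
qed

end

text \<open>A path repeats no arc, and the path extracted from a walk uses only arcs of that walk.\<close>

lemma (in wf_digraph) short_apath:
  assumes "awalk u q v"
  obtains q' where "apath u q' v" "length q' \<le> length q"
proof
  let ?q = "awalk_to_apath q"
  show ap: "apath u ?q v" using assms by (rule apath_awalk_to_apath)
  have "length ?q = card (set ?q)" using ap distinct_card[of ?q] 
    by (metis apath_def distinct_verts_imp_distinct awalkI_apath)
  also have "\<dots> \<le> card (set q)" using assms by (intro card_mono awalk_to_apath_subset) auto
  also have "\<dots> \<le> length q" by (rule card_length)
  finally show "length ?q \<le> length q" .
qed

lemma (in wf_digraph) diameter_le:
  assumes "\<And>u v. u \<in> verts G \<Longrightarrow> v \<in> verts G \<Longrightarrow> \<exists>q. awalk u q v \<and> length q \<le> n"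
  shows "diameter \<le> ereal (real n)"
  unfolding diameter_def
proof (intro SUP_least)
  fix u v assume "u \<in> verts G" "v \<in> verts G"
  then obtain q where q: "awalk u q v" "length q \<le> n" using assms by blast
  have "\<mu> (\<lambda>_. 1) u v \<le> ereal (awalk_cost (\<lambda>_. 1) q)" using q(1) by (rule min_cost_le_walk_cost)
  also have "awalk_cost (\<lambda>_. 1) q = real (length q)" by (simp add: awalk_cost_def sum_list_triv)
  finally show "\<mu> (\<lambda>_. 1) u v \<le> ereal (real n)" using q(2) by (meson ereal_less_eq(3) of_nat_mono order_trans)
qed

section \<open>Components of the local commensurability graph\<close>

context
  fixes G :: "('a, 'b) monoid_scheme" (structure) and p :: nat
    and \<Omega> :: "('a set, 'a set \<times> 'a set) pre_digraph"
  assumes G: "group G" and p: "prime p"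
    and comp: "pre_digraph.connected_component (with_proj (local_commensurability_graph G p)) \<Omega>"
begin

interpretation group G by (rule G)

interpretation \<Gamma>: pair_bidirected_digraph "local_commensurability_graph G p"
  by (rule pair_bidirected_digraph_local_commensurability_graph)

lemma component_sym: "sym_digraph \<Omega>"
  using comp by (rule \<Gamma>.connected_component_sym_digraph)

interpretation \<Omega>: sym_digraph \<Omega>
  by (rule component_sym)

lemma component_induced: "induced_subgraph \<Omega> (with_proj (local_commensurability_graph G p))"
  using comp by (rule \<Gamma>.connected_component_induced)

lemma component_finite_index: "A \<in> verts \<Omega> \<Longrightarrow> A \<in> finite_index_subgroups G"
  using component_induced
  by (auto simp: induced_subgraph_def subgraph_def local_commensurability_graph_def)

lemma component_subgroup: "A \<in> verts \<Omega> \<Longrightarrow> subgroup A G"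
  using component_finite_index by (auto simp: finite_index_subgroups_def)

lemma component_adj_iff:
  "A \<rightarrow>\<^bsub>\<Omega>\<^esub> B \<longleftrightarrow> A \<in> verts \<Omega> \<and> (A, B) \<in> parcs (local_commensurability_graph G p)"
proof -
  have "tail \<Omega> = fst" "head \<Omega> = snd"
    using component_induced by (auto simp: induced_subgraph_def subgraph_def compatible_def)
  then have *: "A \<rightarrow>\<^bsub>\<Omega>\<^esub> B \<longleftrightarrow> (A, B) \<in> arcs \<Omega>" for A B
    by (force simp: arcs_ends_conv)
  show ?thesis
  proof
    assume "A \<rightarrow>\<^bsub>\<Omega>\<^esub> B"
    moreover from this have "(A, B) \<in> arcs \<Omega>" by (rule *[THEN iffD1])
    moreover have "arcs \<Omega> \<subseteq> parcs (local_commensurability_graph G p)"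
      using component_induced by (simp add: induced_subgraph_def subgraph_def)
    ultimately show "A \<in> verts \<Omega> \<and> (A, B) \<in> parcs (local_commensurability_graph G p)"
      using \<Omega>.adj_in_verts(1) by blast
  next
    assume "A \<in> verts \<Omega> \<and> (A, B) \<in> parcs (local_commensurability_graph G p)"
    then have "(A, B) \<in> arcs \<Omega>"
      using \<Gamma>.connected_component_closed[OF comp, of "(A, B)"] by simp
    then show "A \<rightarrow>\<^bsub>\<Omega>\<^esub> B" by (rule *[THEN iffD2])
  qed
qed

lemma component_walk: "A \<in> verts \<Omega> \<Longrightarrow> B \<in> verts \<Omega> \<Longrightarrow> \<exists>q. \<Omega>.awalk A q B"
  using \<Gamma>.connected_component_strongly_connected[OF comp] \<Omega>.reachable_awalk
  by (auto simp: strongly_connected_def)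

text \<open>Induction along a walk from \<open>A\<close>: the two premises of the step say that \<open>B\<close> and \<open>C\<close> are equal or
  adjacent.\<close>

lemma component_induct [consumes 2, case_names base step]:
  assumes "A \<in> verts \<Omega>" "B \<in> verts \<Omega>"
    and base: "P A"
    and step: "\<And>B C. power_index p B (B \<inter> C) \<Longrightarrow> power_index p C (B \<inter> C) \<Longrightarrow> P B \<Longrightarrow> P C"
  shows "P B"
proof -
  have "A \<rightarrow>\<^sup>*\<^bsub>\<Omega>\<^esub> B"
    using component_walk[OF assms(1,2)] \<Omega>.reachable_awalk by blast
  then show ?thesis
  proof (induction rule: \<Omega>.reachable_induct)
    case base
    show ?case by (rule assms(3))
  next
    case (step B C)
    then show ?case using assms(4)[of B C] by (auto simp: component_adj_iff local_commensurability_arc_iff[OF p])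
  qed
qed

text \<open>The property passes between neighbours, and it holds for \<open>B = A\<close> because \<open>NA = A\<close>.\<close>

lemma component_normal_mult:
  assumes A: "A \<in> verts \<Omega>" and N: "N \<lhd> G" "N \<subseteq> A" and B: "B \<in> verts \<Omega>"
  shows "power_index p (N <#> B) B"
  using A B
proof (induction rule: component_induct)
  case base
  have "subgroup N (G\<lparr>carrier := A\<rparr>)"
    using subgroup_incl[OF normal_imp_subgroup[OF N(1)] component_subgroup[OF A] N(2)] .
  then have "A <#> N = A" by (rule set_mult_subgroup_idem[OF component_subgroup[OF A]])
  then have "N <#> A = A" unfolding commut_normal[OF component_subgroup[OF A] N(1)] .
  then show ?case using power_index_refl component_subgroup[OF A] by simp
next
  case (step B C)
  then show ?case using power_index_normal_mult_step[OF p N(1)] by blast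
qed

text \<open>Every vertex \<open>B\<close> equals or is adjacent to \<open>KB\<close>, where \<open>K\<close> is a normal subgroup of finite index inside
  one fixed vertex. Only finitely many subgroups contain \<open>K\<close>, so finitely many walks join those among them that belong to the
  component.\<close>

lemma component_bounded:
  "\<exists>L. \<forall>A\<in>verts \<Omega>. \<forall>B\<in>verts \<Omega>. \<exists>q. \<Omega>.awalk A q B \<and> length q \<le> L"
proof -
  obtain A where A: "A \<in> verts \<Omega>"
    using \<Gamma>.connected_component_strongly_connected[OF comp] by (auto simp: strongly_connected_def)
  obtain K where K: "K \<lhd> G" "K \<subseteq> A" "finite (rcosets K)"
    using component_finite_index[OF A] by (rule finite_index_normal_core)
  define S where "S = {M \<in> verts \<Omega>. K \<subseteq> M}"
  have "S \<subseteq> {M. subgroup M G \<and> K \<subseteq> M}" using component_subgroup by (auto simp: S_def)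
  then have "finite S"
    using finite_overgroups[OF normal_imp_subgroup[OF K(1)] K(3)] finite_subset by blast
  \<comment> \<open>\<open>L\<close> is the length of the longest walk among one chosen for each pair in \<open>S\<close>.\<close>
  define walk where "walk s t = (SOME q. \<Omega>.awalk s q t)" for s t
  have walk: "\<Omega>.awalk s (walk s t) t" if "s \<in> S" "t \<in> S" for s t
    using component_walk[of s t] that unfolding walk_def S_def by (metis (mono_tags, lifting) mem_Collect_eq someI)
  define L where "L = Max ((\<lambda>(s, t). length (walk s t)) ` (S \<times> S))"
  have L: "length (walk s t) \<le> L" if "s \<in> S" "t \<in> S" for s t
    unfolding L_def using that \<open>finite S\<close> by (intro Max_ge) auto
  have dom: "\<exists>s\<in>S. B = s \<or> B \<rightarrow>\<^bsub>\<Omega>\<^esub> s" if B: "B \<in> verts \<Omega>" for B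
  proof -
    let ?M = "K <#> B"
    note KB = set_mult_normal[OF K(1) component_subgroup[OF B]]
    have "power_index p ?M B" using component_normal_mult[OF A K(1,2) B] .
    moreover have "?M \<in> finite_index_subgroups G"
      using finite_index_overgroup[OF component_finite_index[OF B]] KB by blast
    moreover have "B \<inter> ?M = B" using KB by blast
    ultimately have adj: "B = ?M \<or> B \<rightarrow>\<^bsub>\<Omega>\<^esub> ?M"
      using B component_finite_index[OF B] power_index_refl[OF component_subgroup[OF B]]
      by (auto simp: component_adj_iff local_commensurability_arc_iff[OF p])
    then have "?M \<in> verts \<Omega>" using B \<Omega>.adj_in_verts(2) by metis
    then show ?thesis using adj KB unfolding S_def by blast
  qed
  have "\<exists>q. \<Omega>.awalk u q v \<and> length q \<le> L + 2" if "u \<in> verts \<Omega>" "v \<in> verts \<Omega>" for u v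
    using dom walk L that by (intro \<Omega>.walk_bound_of_dominating_set[of S]) blast+
  then show ?thesis by blast
qed

text \<open>Both \<open>B\<close> and \<open>N\<close> have \<open>p\<close>-power index in \<open>NB\<close>, so by the product formula every vertex
  other than \<open>N\<close> is a neighbour of \<open>N\<close>.\<close>

lemma normal_component_bounded:
  assumes N: "N \<in> verts \<Omega>" "N \<lhd> G" and u: "u \<in> verts \<Omega>" and v: "v \<in> verts \<Omega>"
  shows "\<exists>q. \<Omega>.awalk u q v \<and> length q \<le> 2"
proof -
  have N': "subgroup N G" using N by (simp add: normal_imp_subgroup)
  have dom: "B = N \<or> B \<rightarrow>\<^bsub>\<Omega>\<^esub> N" if B: "B \<in> verts \<Omega>" for B
  proof -
    have "power_index p (N <#> B) N"
      using N(1) B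
    proof (induction rule: component_induct)
      case base
      show ?case using power_index_refl N' subgroup_mult_id[OF N'] by simp
    next
      case (step B C)
      then show ?case using power_index_over_normal_step[OF p N(2)] by blast
    qed
    then have "power_index p B (B \<inter> N)" "power_index p N (B \<inter> N)"
      using power_index_Int_normal[OF N(2)] component_normal_mult[OF N order_refl B] by blast+
    then show ?thesis
      using B N component_finite_index by (auto simp: component_adj_iff local_commensurability_arc_iff[OF p])
  qed
  have "\<exists>q. \<Omega>.awalk u q v \<and> length q \<le> 0 + 2"
    using u v
  proof (intro \<Omega>.walk_bound_of_dominating_set[of "{N}"])
    show "\<exists>q. \<Omega>.awalk s q t \<and> length q \<le> 0" if "s \<in> {N}" "t \<in> {N}" for s t
      using that N by (auto simp: \<Omega>.awalk_Nil_iff)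
  qed (use dom in auto)
  then show ?thesis by (simp only: add_0)
qed

end

theorem proposition3:
  fixes G :: "('a, 'b) monoid_scheme"
    and p :: nat
    and \<Omega> :: "('a set, 'a set \<times> 'a set) pre_digraph"
  assumes "group G"
    and "prime p"
    and "pre_digraph.connected_component (with_proj (local_commensurability_graph G p)) \<Omega>"
  shows "(\<exists>C::nat. C > 0 \<and>
        (\<forall>A\<in>verts \<Omega>. \<forall>B\<in>verts \<Omega>.
          \<exists>q. pre_digraph.apath \<Omega> A q B \<and> length q < C)) \<and>
      wf_digraph.diameter \<Omega> < \<infinity> \<and>
      ((\<exists>N\<in>verts \<Omega>. N \<lhd> G) \<longrightarrow> wf_digraph.diameter \<Omega> \<le> 3)"
proof (intro conjI impI)
  interpret \<Omega>: sym_digraph \<Omega>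
    using assms by (rule component_sym)
  obtain L where L: "\<And>A B. A \<in> verts \<Omega> \<Longrightarrow> B \<in> verts \<Omega> \<Longrightarrow> \<exists>q. \<Omega>.awalk A q B \<and> length q \<le> L"
    using component_bounded[OF assms] by blast
  have "\<exists>q. \<Omega>.apath A q B \<and> length q < Suc L" if "A \<in> verts \<Omega>" "B \<in> verts \<Omega>" for A B
    using L[OF that] \<Omega>.short_apath by (metis le_trans less_Suc_eq_le)
  then show "\<exists>C::nat. C > 0 \<and>
      (\<forall>A\<in>verts \<Omega>. \<forall>B\<in>verts \<Omega>. \<exists>q. \<Omega>.apath A q B \<and> length q < C)"
    by (intro exI[of _ "Suc L"]) auto
  have "\<Omega>.diameter \<le> ereal (real L)" using L by (rule \<Omega>.diameter_le)
  then show "\<Omega>.diameter < \<infinity>" by (rule le_less_trans) simp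
  assume "\<exists>N\<in>verts \<Omega>. N \<lhd> G"
  then have "\<Omega>.diameter \<le> ereal (real 2)"
    using normal_component_bounded[OF assms] by (intro \<Omega>.diameter_le) blast
  also have "\<dots> \<le> 3" by simp
  finally show "\<Omega>.diameter \<le> 3" .
qed

end
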